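(* Let $\gamma>0$, let $n\in\mathbb{N}$, and let $T$ be the rank-one operator on $\mathcal{H}_\gamma(\mathbb{D})$ given by $T(f)=\langle f,z^n\rangle z^n$ for $f\in\mathcal{H}_\gamma(\mathbb{D})$. Then $$\mathrm{Ber}(T)=\left[0,\ \frac{\gamma^\gamma n^n}{(n+\gamma)^{n+\gamma}}\right],$$ which is convex in $\mathbb{C}$.
   Context: $\mathbb{N}$ denotes the positive integers and $\mathbb{D}$ the open unit disc in $\mathbb{C}$. For $\gamma>0$, $\mathcal{H}_\gamma(\mathbb{D})$ is the reproducing kernel Hilbert space of holomorphic functions on $\mathbb{D}$ with reproducing kernel $k_\lambda(z)=(1-\overline{\lambda}z)^{-\gamma}$ for $\lambda,z\in\mathbb{D}$ (principal branch), so $\langle f,k_\lambda\rangle=f(\lambda)$ and $\|k_\lambda\|^2=(1-|\lambda|^2)^{-\gamma}$. Put $\widehat{k}_\lambda=k_\lambda/\|k_\lambda\|$. For a bounded linear operator $T$ on $\mathcal{H}_\gamma(\mathbb{D})$, the Berezin transform is $\widetilde{T}(\lambda)=\langle T\widehat{k}_\lambda,\widehat{k}_\lambda\rangle$ for $\lambda\in\mathbb{D}$, and the Berezin range is $\mathrm{Ber}(T)=\{\widetilde{T}(\lambda):\lambda\in\mathbb{D}\}\subseteq\mathbb{C}$. Here $z^n$ denotes the function $z\mapsto z^n$. *)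

theory Defs
  imports "HOL-Complex_Analysis.Complex_Analysis"
begin

text \<open>
  A reproducing kernel Hilbert space of complex functions on a set \<open>X\<close> is given by its carrier
  \<open>H\<close> and its inner product \<open>ip\<close>, linear in the first argument. HOL functions are total, so a
  function on \<open>X\<close> is represented by its extension by \<open>0\<close>; this makes equality in \<open>H\<close> coincide
  with equality on \<open>X\<close>. The inner product is unconstrained outside \<open>H\<close>.
\<close>

definition ip_norm :: "(('a \<Rightarrow> complex) \<Rightarrow> ('a \<Rightarrow> complex) \<Rightarrow> complex) \<Rightarrow> ('a \<Rightarrow> complex) \<Rightarrow> real"
  where "ip_norm ip f = sqrt (Re (ip f f))"

locale function_hilbert_space =
  fixes X :: "'a set"
    and H :: "('a \<Rightarrow> complex) set"
    and ip :: "('a \<Rightarrow> complex) \<Rightarrow> ('a \<Rightarrow> complex) \<Rightarrow> complex"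
  assumes zero_outside: "\<And>f x. f \<in> H \<Longrightarrow> x \<notin> X \<Longrightarrow> f x = 0"
    and zero_mem: "(\<lambda>x. 0) \<in> H"
    and add_mem: "\<And>f g. f \<in> H \<Longrightarrow> g \<in> H \<Longrightarrow> (\<lambda>x. f x + g x) \<in> H"
    and scale_mem: "\<And>c f. f \<in> H \<Longrightarrow> (\<lambda>x. c * f x) \<in> H"
    and ip_add_left: "\<And>f g h. f \<in> H \<Longrightarrow> g \<in> H \<Longrightarrow> h \<in> H
          \<Longrightarrow> ip (\<lambda>x. f x + g x) h = ip f h + ip g h"
    and ip_scale_left: "\<And>c f g. f \<in> H \<Longrightarrow> g \<in> H \<Longrightarrow> ip (\<lambda>x. c * f x) g = c * ip f g"
    and ip_commute: "\<And>f g. f \<in> H \<Longrightarrow> g \<in> H \<Longrightarrow> ip g f = cnj (ip f g)"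
    and ip_self_nonneg: "\<And>f. f \<in> H \<Longrightarrow> 0 \<le> Re (ip f f)"
    and ip_self_eq_0: "\<And>f. f \<in> H \<Longrightarrow> ip f f = 0 \<Longrightarrow> f = (\<lambda>x. 0)"
    and complete: "\<And>s :: nat \<Rightarrow> 'a \<Rightarrow> complex.
          (\<And>i. s i \<in> H) \<Longrightarrow>
          (\<And>e. e > 0 \<Longrightarrow> \<exists>N. \<forall>i\<ge>N. \<forall>j\<ge>N. ip_norm ip (\<lambda>x. s i x - s j x) < e) \<Longrightarrow>
          \<exists>f\<in>H. (\<lambda>i. ip_norm ip (\<lambda>x. s i x - f x)) \<longlonglongrightarrow> 0"

locale rkhs = function_hilbert_space X H ip
  for X :: "'a set"
    and H :: "('a \<Rightarrow> complex) set"
    and ip :: "('a \<Rightarrow> complex) \<Rightarrow> ('a \<Rightarrow> complex) \<Rightarrow> complex" +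
  fixes k :: "'a \<Rightarrow> 'a \<Rightarrow> complex"
  assumes kernel_mem: "\<And>l. l \<in> X \<Longrightarrow> k l \<in> H"
    and reproducing: "\<And>f l. f \<in> H \<Longrightarrow> l \<in> X \<Longrightarrow> ip f (k l) = f l"

definition normalized_kernel ::
    "(('a \<Rightarrow> complex) \<Rightarrow> ('a \<Rightarrow> complex) \<Rightarrow> complex) \<Rightarrow> ('a \<Rightarrow> 'a \<Rightarrow> complex) \<Rightarrow> 'a \<Rightarrow> 'a \<Rightarrow> complex"
  where "normalized_kernel ip k l = (\<lambda>x. k l x / of_real (ip_norm ip (k l)))"

definition berezin_transform ::
    "(('a \<Rightarrow> complex) \<Rightarrow> ('a \<Rightarrow> complex) \<Rightarrow> complex) \<Rightarrow> ('a \<Rightarrow> 'a \<Rightarrow> complex)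
      \<Rightarrow> (('a \<Rightarrow> complex) \<Rightarrow> ('a \<Rightarrow> complex)) \<Rightarrow> 'a \<Rightarrow> complex"
  where "berezin_transform ip k T l = ip (T (normalized_kernel ip k l)) (normalized_kernel ip k l)"

definition berezin_range ::
    "'a set \<Rightarrow> (('a \<Rightarrow> complex) \<Rightarrow> ('a \<Rightarrow> complex) \<Rightarrow> complex) \<Rightarrow> ('a \<Rightarrow> 'a \<Rightarrow> complex)
      \<Rightarrow> (('a \<Rightarrow> complex) \<Rightarrow> ('a \<Rightarrow> complex)) \<Rightarrow> complex set"
  where "berezin_range X ip k T = berezin_transform ip k T ` X"

abbreviation unit_disc :: "complex set"
  where "unit_disc \<equiv> ball 0 1"

definition on_disc :: "(complex \<Rightarrow> complex) \<Rightarrow> complex \<Rightarrow> complex"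
  where "on_disc f = (\<lambda>z. if z \<in> unit_disc then f z else 0)"

text \<open>Complex \<open>powr\<close> is defined through the principal branch \<open>Ln\<close>.\<close>

definition disc_kernel :: "real \<Rightarrow> complex \<Rightarrow> complex \<Rightarrow> complex"
  where "disc_kernel \<gamma> l = on_disc (\<lambda>z. (1 - cnj l * z) powr (- of_real \<gamma>))"

text \<open>
  A kernel determines its Hilbert space of functions uniquely (Moore-Aronszajn), so this predicate
  pins down \<open>H\<close>, and \<open>ip\<close> on \<open>H\<close>.
\<close>

locale disc_rkhs = rkhs unit_disc H ip "disc_kernel \<gamma>"
  for \<gamma> :: real
    and H :: "(complex \<Rightarrow> complex) set"
    and ip :: "(complex \<Rightarrow> complex) \<Rightarrow> (complex \<Rightarrow> complex) \<Rightarrow> complex" +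
  assumes holomorphic: "\<And>f. f \<in> H \<Longrightarrow> f holomorphic_on unit_disc"

end

theory Submission
  imports Defs
begin

text \<open>
  Once \<open>z\<^sup>n\<close> is known to lie in the space, the reproducing property gives the Berezin transform
  \<open>t\<^sup>n (1 - t)\<^sup>\<gamma>\<close> with \<open>t = |\<lambda>|\<^sup>2 \<in> [0, 1)\<close>; its maximum is at \<open>t = n / (n + \<gamma>)\<close>, and the
  intermediate value theorem fills the interval. That \<open>z\<^sup>n\<close> lies in the space has to be extracted
  from the kernel: discrete Fourier averages of kernels on a circle form a Cauchy sequence whose
  limit is a nonzero multiple of \<open>z\<^sup>n\<close>.
\<close>

section \<open>Inner product algebra, Cauchy-Schwarz and a convergence criterion\<close>

context function_hilbert_space
begin

lemma diff_mem:
  assumes "f \<in> H" "g \<in> H"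
  shows "(\<lambda>x. f x - g x) \<in> H"
  using add_mem[OF assms(1) scale_mem[OF assms(2), of "-1"]] by simp

lemma sum_mem: "(\<And>i. i \<in> A \<Longrightarrow> f i \<in> H) \<Longrightarrow> (\<lambda>x. \<Sum>i\<in>A. f i x) \<in> H"
  by (induction A rule: infinite_finite_induct) (simp_all add: zero_mem add_mem)

lemma ip_diff_left:
  assumes "f \<in> H" "g \<in> H" "h \<in> H"
  shows "ip (\<lambda>x. f x - g x) h = ip f h - ip g h"
  using ip_add_left[OF assms(1) scale_mem[OF assms(2), of "-1"] assms(3)]
    ip_scale_left[OF assms(2,3), of "-1"] by simp

lemma ip_zero_left: "g \<in> H \<Longrightarrow> ip (\<lambda>x. 0) g = 0"
  using ip_scale_left[OF zero_mem, of g 0] by simp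

lemma ip_zero_right: "f \<in> H \<Longrightarrow> ip f (\<lambda>x. 0) = 0"
  using ip_commute[OF zero_mem, of f] by (simp add: ip_zero_left)

lemma ip_diff_right:
  assumes "f \<in> H" "g \<in> H" "h \<in> H"
  shows "ip h (\<lambda>x. f x - g x) = ip h f - ip h g"
  using ip_commute[OF diff_mem[OF assms(1,2)] assms(3)] ip_diff_left[OF assms]
    ip_commute[OF assms(1,3)] ip_commute[OF assms(2,3)] by simp

lemma ip_scale_right:
  assumes "f \<in> H" "g \<in> H"
  shows "ip g (\<lambda>x. c * f x) = cnj c * ip g f"
  using ip_commute[OF scale_mem[OF assms(1), of c] assms(2)] ip_scale_left[OF assms]
    ip_commute[OF assms] by simp

lemma ip_sum_left:
  assumes "\<And>i. i \<in> A \<Longrightarrow> f i \<in> H" "g \<in> H"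
  shows "ip (\<lambda>x. \<Sum>i\<in>A. f i x) g = (\<Sum>i\<in>A. ip (f i) g)"
  using assms(1)
  by (induction A rule: infinite_finite_induct)
    (simp_all add: ip_zero_left ip_add_left sum_mem assms(2))

lemma ip_sum_right:
  assumes "\<And>i. i \<in> A \<Longrightarrow> f i \<in> H" "g \<in> H"
  shows "ip g (\<lambda>x. \<Sum>i\<in>A. f i x) = (\<Sum>i\<in>A. ip g (f i))"
proof -
  have "(\<lambda>x. \<Sum>i\<in>A. f i x) \<in> H" using assms(1) by (rule sum_mem)
  from ip_commute[OF this assms(2)]
  have "ip g (\<lambda>x. \<Sum>i\<in>A. f i x) = cnj (\<Sum>i\<in>A. ip (f i) g)"
    using ip_sum_left[OF assms, of A "\<lambda>i. i"] by simp
  also have "\<dots> = (\<Sum>i\<in>A. ip g (f i))"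
    unfolding cnj_sum by (intro sum.cong refl ip_commute[symmetric] assms)
  finally show ?thesis .
qed

lemma ip_self_real: "f \<in> H \<Longrightarrow> ip f f = of_real (Re (ip f f))"
  using ip_commute[of f f] by (metis Reals_cnj_iff of_real_Re)

lemma ip_norm_power2: "f \<in> H \<Longrightarrow> (ip_norm ip f)\<^sup>2 = Re (ip f f)"
  by (simp add: ip_norm_def ip_self_nonneg)

lemma Cauchy_Schwarz:
  assumes f: "f \<in> H" and g: "g \<in> H"
  shows "norm (ip f g) \<le> ip_norm ip f * ip_norm ip g"
proof (cases "ip g g = 0")
  case True
  then have "g = (\<lambda>x. 0)" using ip_self_eq_0 g by simp
  then show ?thesis using f by (simp add: ip_zero_right ip_norm_def ip_zero_left zero_mem)
next
  case False
  define a where "a = Re (ip g g)"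
  define b where "b = Re (ip f f)"
  define c where "c = ip f g"
  have a: "ip g g = of_real a" and b: "ip f f = of_real b"
    unfolding a_def b_def by (rule ip_self_real[OF g], rule ip_self_real[OF f])
  have "a \<ge> 0" unfolding a_def by (rule ip_self_nonneg[OF g])
  moreover have "a \<noteq> 0" using False a by auto
  ultimately have apos: "a > 0" by simp
  have gf: "ip g f = cnj c" using ip_commute[OF f g] c_def by simp
  \<comment> \<open>\<open>?h\<close> is \<open>a\<close> times the component of \<open>f\<close>
    orthogonal to \<open>g\<close>; the scaling by \<open>a\<close> avoids a division.\<close>
  let ?h = "\<lambda>x. of_real a * f x - c * g x"
  have m: "(\<lambda>x. of_real a * f x) \<in> H" "(\<lambda>x. c * g x) \<in> H" using f g scale_mem by auto
  have "ip ?h ?h = of_real a * (of_real a * of_real b - c * cnj c)"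
    using f g m
    by (simp add: ip_diff_left ip_diff_right diff_mem ip_scale_left ip_scale_right a b gf
        c_def[symmetric] algebra_simps)
  also have "\<dots> = of_real (a * (a * b - (norm c)\<^sup>2))"
    using complex_norm_square[of c] by simp
  finally have "0 \<le> a * (a * b - (norm c)\<^sup>2)"
    using ip_self_nonneg[OF diff_mem[OF m]] by simp
  then have "(norm c)\<^sup>2 \<le> b * a" using apos by (simp add: zero_le_mult_iff mult.commute)
  then have "norm c \<le> sqrt (b * a)" by (rule real_le_rsqrt)
  then show ?thesis by (simp add: real_sqrt_mult ip_norm_def a_def b_def c_def)
qed

text \<open>Expanding the squared norm of \<open>s i - s j\<close> gives four Gram entries with
  signs +, -, -, +, so the common value \<open>L\<close> cancels and each entry contributes an error
  below \<open>e\<^sup>2 / 4\<close>.\<close>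

lemma norm_convergent_if_ip_convergent:
  fixes s :: "nat \<Rightarrow> 'a \<Rightarrow> complex"
  assumes s: "\<And>i. s i \<in> H" and \<epsilon>: "\<epsilon> \<longlonglongrightarrow> 0"
    and ip: "\<And>i j. norm (ip (s i) (s j) - L) \<le> \<epsilon> i"
  shows "\<exists>f\<in>H. (\<lambda>i. ip_norm ip (\<lambda>x. s i x - f x)) \<longlonglongrightarrow> 0"
proof (rule complete)
  fix e :: real assume e: "e > 0"
  from \<epsilon> have "eventually (\<lambda>i. \<epsilon> i < e\<^sup>2 / 4) sequentially"
    using e by (intro order_tendstoD) auto
  then obtain N where N: "\<And>i. i \<ge> N \<Longrightarrow> \<epsilon> i < e\<^sup>2 / 4"
    by (auto simp: eventually_sequentially)
  have "ip_norm ip (\<lambda>x. s i x - s j x) < e" if ij: "i \<ge> N" "j \<ge> N" for i j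
  proof -
    have "(ip_norm ip (\<lambda>x. s i x - s j x))\<^sup>2 = Re (ip (\<lambda>x. s i x - s j x) (\<lambda>x. s i x - s j x))"
      by (simp add: ip_norm_power2 diff_mem s)
    also have "\<dots> = Re ((ip (s i) (s i) - L) - (ip (s i) (s j) - L)
        - (ip (s j) (s i) - L) + (ip (s j) (s j) - L))"
      by (simp add: ip_diff_left ip_diff_right diff_mem s)
    also have "\<dots> \<le> norm (ip (s i) (s i) - L) + norm (ip (s i) (s j) - L)
        + norm (ip (s j) (s i) - L) + norm (ip (s j) (s j) - L)"
      using abs_Re_le_cmod[of "ip (s i) (s i) - L"] abs_Re_le_cmod[of "ip (s i) (s j) - L"]
        abs_Re_le_cmod[of "ip (s j) (s i) - L"] abs_Re_le_cmod[of "ip (s j) (s j) - L"]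
      by simp
    also have "\<dots> < e\<^sup>2"
      using ip[of i i] ip[of i j] ip[of j i] ip[of j j] N[OF ij(1)] N[OF ij(2)] by linarith
    finally show ?thesis using e by (auto intro: power2_less_imp_less)
  qed
  then show "\<exists>N. \<forall>i\<ge>N. \<forall>j\<ge>N. ip_norm ip (\<lambda>x. s i x - s j x) < e" by blast
qed (rule s)

end

text \<open>Evaluation at \<open>l\<close> is the inner product with \<open>k l\<close>, hence
  bounded by Cauchy-Schwarz.\<close>

lemma (in rkhs) tendsto_pointwise:
  assumes s: "\<And>i. s i \<in> H" and f: "f \<in> H" and l: "l \<in> X"
    and lim: "(\<lambda>i. ip_norm ip (\<lambda>x. s i x - f x)) \<longlonglongrightarrow> 0"
  shows "(\<lambda>i. s i l) \<longlonglongrightarrow> f l"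
proof (rule LIM_zero_cancel, rule Lim_null_comparison)
  show "\<forall>\<^sub>F i in sequentially.
      norm (s i l - f l) \<le> ip_norm ip (\<lambda>x. s i x - f x) * ip_norm ip (k l)"
    using Cauchy_Schwarz[OF diff_mem[OF s f] kernel_mem[OF l]]
      reproducing[OF diff_mem[OF s f] l] by simp
  show "(\<lambda>i. ip_norm ip (\<lambda>x. s i x - f x) * ip_norm ip (k l)) \<longlonglongrightarrow> 0"
    using tendsto_mult_right[OF lim, of "ip_norm ip (k l)"] by simp
qed

section \<open>Roots of unity and discrete Fourier averages of power series\<close>

definition unity_root :: "nat \<Rightarrow> nat \<Rightarrow> complex"
  where "unity_root N j = cis (2 * pi * real j / real N)"

lemma norm_unity_root [simp]: "norm (unity_root N j) = 1"
  by (simp add: unity_root_def)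

lemma unity_root_mult_cnj: "unity_root N j * cnj (unity_root N j) = 1"
  using complex_norm_square[of "unity_root N j"] by simp

text \<open>The terms form a geometric progression in \<open>j\<close> whose ratio \<open>x\<close>
  satisfies \<open>x ^ N = 1\<close>; the ratio is not 1 because 0 < |n - m| < N.\<close>

lemma unity_root_orthogonal:
  assumes "n < N" "m < N" "n \<noteq> m"
  shows "(\<Sum>j<N. unity_root N j ^ n * cnj (unity_root N j) ^ m) = 0"
proof -
  define x where "x = cis (2 * pi * (real n - real m) / real N)"
  have term_eq: "unity_root N j ^ n * cnj (unity_root N j) ^ m = x ^ j" for j
    unfolding unity_root_def x_def cis_cnj Complex.DeMoivre cis_mult
    by (rule arg_cong[of _ _ cis]) (simp add: diff_divide_distrib algebra_simps)
  have xN: "x ^ N = 1"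
  proof -
    have "x ^ N = cis (2 * pi * of_int (int n - int m))"
      using assms by (simp add: x_def Complex.DeMoivre)
    also have "\<dots> = 1" by (rule cis_multiple_2pi) simp
    finally show ?thesis .
  qed
  have "x \<noteq> 1"
  proof
    assume "x = 1"
    then obtain q :: int where q: "2 * pi * (real n - real m) / real N = of_int q * 2 * pi"
      unfolding x_def by (auto simp: complex_eq_iff cos_one_2pi_int)
    then have "2 * pi * (real n - real m) = 2 * pi * (of_int q * real N)"
      using assms by (simp add: field_simps)
    then have "real n - real m = of_int q * real N"
      by (metis mult_cancel_left pi_neq_zero zero_neq_numeral mult_eq_0_iff)
    then have "real_of_int (int n - int m) = real_of_int (q * int N)" by simp
    then have "int n - int m = q * int N" by (subst (asm) of_int_eq_iff)
    then have "int N dvd int n - int m" by simp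
    then show False using assms dvd_imp_le_int[of "int n - int m" "int N"] by simp
  qed
  then show ?thesis unfolding term_eq geometric_sum[OF \<open>x \<noteq> 1\<close>] xN by simp
qed

text \<open>
  Averaging a power series against the \<open>N\<close>-th roots of unity keeps only the exponents
  congruent to \<open>n\<close> modulo \<open>N\<close>; apart from \<open>n\<close> itself these are all at least \<open>N\<close>.
\<close>

lemma unity_root_average_bound:
  fixes c :: "nat \<Rightarrow> complex"
  assumes h: "\<And>u. norm u \<le> r \<Longrightarrow> (\<lambda>m. c m * u ^ m) sums h u"
    and summable: "summable (\<lambda>m. norm (c m) * r ^ m)"
    and N: "n < N" and u: "norm u \<le> r"
  shows "norm ((\<Sum>j<N. unity_root N j ^ n * h (cnj (unity_root N j) * u)) / of_nat N - c n * u ^ n)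
      \<le> (\<Sum>m. norm (c (m + N)) * r ^ (m + N))"
proof -
  \<comment> \<open>\<open>\<delta> m\<close> is the filter on exponents: 1 at \<open>n\<close> and
    0 at every other \<open>m < N\<close>. For \<open>m \<ge> N\<close> the bound by 1 is
    enough.\<close>
  define \<delta> where "\<delta> m = (\<Sum>j<N. unity_root N j ^ n * cnj (unity_root N j) ^ m) / of_nat N" for m
  have \<delta>_n: "\<delta> n = 1"
    using N by (simp add: \<delta>_def unity_root_mult_cnj flip: power_mult_distrib)
  have \<delta>_0: "\<delta> m = 0" if "m < N" "m \<noteq> n" for m
    using unity_root_orthogonal[of n N m] N that by (simp add: \<delta>_def)
  have \<delta>_le: "norm (\<delta> m) \<le> 1" for m
  proof -
    have "norm (\<Sum>j<N. unity_root N j ^ n * cnj (unity_root N j) ^ m) \<le> (\<Sum>j<N. 1)"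
      by (rule sum_norm_le) (simp add: norm_mult norm_power)
    then show ?thesis using N by (simp add: \<delta>_def norm_divide)
  qed
  have r: "r \<ge> 0" using u norm_ge_zero order_trans by blast
  have "(\<lambda>m. \<Sum>j<N. unity_root N j ^ n * (c m * (cnj (unity_root N j) * u) ^ m))
      sums (\<Sum>j<N. unity_root N j ^ n * h (cnj (unity_root N j) * u))"
    by (intro sums_sum sums_mult h) (simp add: norm_mult u)
  then have "(\<lambda>m. (\<Sum>j<N. unity_root N j ^ n * (c m * (cnj (unity_root N j) * u) ^ m)) / of_nat N)
      sums ((\<Sum>j<N. unity_root N j ^ n * h (cnj (unity_root N j) * u)) / of_nat N)" (is "_ sums ?A")
    by (rule sums_divide)
  also have "(\<lambda>m. (\<Sum>j<N. unity_root N j ^ n * (c m * (cnj (unity_root N j) * u) ^ m)) / of_nat N)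
      = (\<lambda>m. \<delta> m * (c m * u ^ m))"
    by (simp add: \<delta>_def sum_distrib_left sum_distrib_right power_mult_distrib mult_ac fun_eq_iff)
  finally have A: "(\<lambda>m. \<delta> m * (c m * u ^ m)) sums ?A" .
  \<comment> \<open>Among the first \<open>N\<close> terms only the one at \<open>n\<close>
    survives, so the tail is exactly the error of the average.\<close>
  have "(\<lambda>m. \<delta> (m + N) * (c (m + N) * u ^ (m + N)))
      sums (?A - (\<Sum>m<N. \<delta> m * (c m * u ^ m)))"
    using sums_split_initial_segment[OF A, of N] by simp
  also have "(\<Sum>m<N. \<delta> m * (c m * u ^ m)) = (\<Sum>m<N. if m = n then c n * u ^ n else 0)"
    by (intro sum.cong) (auto simp: \<delta>_n \<delta>_0)
  also have "\<dots> = c n * u ^ n" using N by simp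
  finally have tail: "(\<lambda>m. \<delta> (m + N) * (c (m + N) * u ^ (m + N))) sums (?A - c n * u ^ n)" .
  have tb: "norm (\<delta> (m + N) * (c (m + N) * u ^ (m + N))) \<le> norm (c (m + N)) * r ^ (m + N)" for m
  proof -
    have "norm (\<delta> (m + N)) * (norm (c (m + N)) * norm u ^ (m + N))
        \<le> 1 * (norm (c (m + N)) * r ^ (m + N))"
      using u r by (intro mult_mono \<delta>_le power_mono order_refl) auto
    then show ?thesis by (simp add: norm_mult norm_power)
  qed
  show ?thesis
    unfolding sums_unique[OF tail]
    by (rule norm_suminf_le[OF tb summable_ignore_initial_segment[OF summable]])
qed

section \<open>Membership of the monomials in the space\<close>

text \<open>Up to sign and \<open>n!\<close> this is the rising factorial of \<gamma>, a product of
  positive factors. It makes the Taylor coefficients of the kernel nonzero.\<close>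

lemma gbinomial_minus_ne_0:
  assumes "\<gamma> > 0"
  shows "(- of_real \<gamma> :: complex) gchoose n \<noteq> 0"
proof -
  have "pochhammer (of_real \<gamma> :: complex) n \<noteq> 0"
  proof
    assume "pochhammer (of_real \<gamma> :: complex) n = 0"
    then obtain j where "(of_real \<gamma> :: complex) = - of_nat j" by (auto simp: pochhammer_eq_0_iff)
    then have "\<gamma> = - real j" by (metis of_real_eq_iff of_real_minus of_real_of_nat_eq)
    then show False using assms by simp
  qed
  then show ?thesis by (simp add: gbinomial_pochhammer)
qed

text \<open>
  The averages \<open>s N\<close> of the kernels \<open>k\<^sub>\<lambda>\<close> over \<open>\<lambda> = (1/2)\<omega>\<close>, \<open>\<omega>\<^sup>N = 1\<close>, with weights \<open>\<omega>\<^sup>n\<close>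
  converge in \<open>H\<close> to a nonzero multiple of \<open>z\<^sup>n\<close>.
\<close>

lemma (in disc_rkhs) monomial_mem:
  assumes \<gamma>: "\<gamma> > 0"
  shows "on_disc (\<lambda>w. w ^ n) \<in> H"
proof -
  define c where "c m = ((- of_real \<gamma> :: complex) gchoose m) * (-1) ^ m" for m
  define h where "h u = (1 - u) powr (- of_real \<gamma> :: complex)" for u :: complex
  have h: "(\<lambda>m. c m * u ^ m) sums h u" if "norm u < 1" for u
    using gen_binomial_complex[of "- u" "- of_real \<gamma>"] that
    by (simp add: c_def h_def mult.assoc flip: power_mult_distrib)
  \<comment> \<open>The choice 3/4 stands for any radius between 1/2 and 1: convergence there gives
    absolute convergence at 1/2.\<close>
  have summable: "summable (\<lambda>m. norm (c m) * (1/2) ^ m)"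
    using powser_insidea[OF sums_summable[OF h, of "3/4"], of "1/2"]
    by (simp add: norm_mult norm_power norm_divide)
  have c: "c n \<noteq> 0" using gbinomial_minus_ne_0[OF \<gamma>] by (simp add: c_def)
  define p where "p N j = unity_root N j / 2" for N j
  have p: "p N j \<in> unit_disc" for N j by (simp add: p_def norm_divide)
  define w where "w N j = unity_root N j ^ n / of_nat N" for N j
  define s where "s N = (\<lambda>z. \<Sum>j<N. w N j * disc_kernel \<gamma> (p N j) z)" for N
  \<comment> \<open>The expected limit of the Gram entries: one factor \<open>(1/2) ^ n\<close>
    comes from the circle carrying the kernels of \<open>s N\<close>, the other from the points at
    which \<open>s M\<close> evaluates.\<close>
  define L where "L = c n * (1/2) ^ n * (1/2) ^ n"
  define \<epsilon> where "\<epsilon> N = (\<Sum>m. norm (c (m + N)) * (1/2) ^ (m + N))" for N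
  have \<epsilon>: "\<epsilon> \<longlonglongrightarrow> 0"
    unfolding \<epsilon>_def by (rule suminf_exist_split2[OF summable])
  have sm: "s N \<in> H" for N
    unfolding s_def by (intro sum_mem scale_mem kernel_mem p)
  \<comment> \<open>The argument of \<open>h\<close> has modulus |z/2| \<le> 1/2, which makes the
    bound uniform in \<open>z\<close>.\<close>
  have s: "norm (s N z - c n * (z / 2) ^ n) \<le> \<epsilon> N" if "n < N" "z \<in> unit_disc" for N z
  proof -
    have "s N z = (\<Sum>j<N. unity_root N j ^ n * h (cnj (unity_root N j) * (z / 2))) / of_nat N"
      using that(2)
      by (simp add: s_def w_def p_def disc_kernel_def on_disc_def h_def sum_divide_distrib)
    then show ?thesis
      unfolding \<epsilon>_def using that
      by (simp only:, intro unity_root_average_bound[OF h summable]) (auto simp: norm_divide)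
  qed
  have ip_right: "ip f (s N) = (\<Sum>j<N. cnj (w N j) * f (p N j))" if "f \<in> H" for f N
    unfolding s_def using that p
    by (simp add: ip_sum_right scale_mem kernel_mem ip_scale_right reproducing)
  \<comment> \<open>By \<open>ip_right\<close> the Gram entry is a weighted average of
    \<open>s N\<close> over \<open>M\<close> nodes. Replacing \<open>s N\<close> by its limit gives
    exactly \<open>L\<close>, and the weights have modulus 1/M, so the error bound does not depend
    on \<open>M\<close>.\<close>
  have gram: "norm (ip (s N) (s M) - L) \<le> \<epsilon> N" if "n < N" "n < M" for N M
  proof -
    have M: "M > 0" using that by simp
    have "(\<Sum>j<M. cnj (w M j) * (c n * (p M j / 2) ^ n)) = (\<Sum>j<M. L / of_nat M)"
    proof (intro sum.cong refl)
      fix j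
      have "cnj (unity_root M j) ^ n * unity_root M j ^ n = 1"
        using unity_root_mult_cnj[of M j] by (metis mult.commute power_mult_distrib power_one)
      then show "cnj (w M j) * (c n * (p M j / 2) ^ n) = L / of_nat M"
        by (simp add: w_def p_def L_def field_simps flip: power_mult_distrib)
    qed
    also have "\<dots> = L" using M by simp
    finally have "ip (s N) (s M) - L
        = (\<Sum>j<M. cnj (w M j) * (s N (p M j) - c n * (p M j / 2) ^ n))"
      by (simp add: ip_right sm right_diff_distrib sum_subtractf)
    also have "norm \<dots> \<le> (\<Sum>j<M. 1 / real M * \<epsilon> N)"
    proof (rule sum_norm_le)
      fix j
      show "norm (cnj (w M j) * (s N (p M j) - c n * (p M j / 2) ^ n)) \<le> 1 / real M * \<epsilon> N"
        unfolding norm_mult using s[OF that(1) p]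
        by (intro mult_mono) (auto simp: w_def norm_divide norm_power)
    qed
    also have "\<dots> = \<epsilon> N" using M by simp
    finally show ?thesis .
  qed
  \<comment> \<open>The estimates need \<open>n < N\<close>, so the sequence starts at index
    \<open>Suc n\<close>.\<close>
  have shift: "(\<lambda>i. \<epsilon> (i + Suc n)) \<longlonglongrightarrow> 0"
    using \<epsilon> by (rule LIMSEQ_ignore_initial_segment)
  obtain f where f: "f \<in> H" "(\<lambda>i. ip_norm ip (\<lambda>x. s (i + Suc n) x - f x)) \<longlonglongrightarrow> 0"
    using norm_convergent_if_ip_convergent[of "\<lambda>i. s (i + Suc n)", OF sm shift gram] by auto
  \<comment> \<open>The norm limit \<open>f\<close> is identified through its point values.\<close>
  have fz: "f z = c n * (z / 2) ^ n" if z: "z \<in> unit_disc" for z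
  proof (rule LIMSEQ_unique)
    show "(\<lambda>i. s (i + Suc n) z) \<longlonglongrightarrow> f z"
      by (rule tendsto_pointwise[OF sm f(1) z f(2)])
    show "(\<lambda>i. s (i + Suc n) z) \<longlonglongrightarrow> c n * (z / 2) ^ n"
      by (rule LIM_zero_cancel, rule Lim_null_comparison[OF _ shift]) (use s z in auto)
  qed
  \<comment> \<open>Outside the disc both sides vanish, the right one by
    \<open>zero_outside\<close>.\<close>
  have "on_disc (\<lambda>w. w ^ n) = (\<lambda>z. (2 ^ n / c n) * f z)"
    using c zero_outside[OF f(1)] by (auto simp: on_disc_def fz fun_eq_iff field_simps)
  then show ?thesis using scale_mem[OF f(1), of "2 ^ n / c n"] by simp
qed

section \<open>The Berezin transform of a rank-one operator\<close>

text \<open>For the normalized kernel \<kappa>, <T \<kappa>, \<kappa>> = <\<kappa>, g> <g, \<kappa>>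
  = |<g, \<kappa>>|^2, and the reproducing property turns this into |g(l)|^2 divided by the squared
  norm of the kernel.\<close>

lemma berezin_transform_rank_one:
  assumes "disc_rkhs \<gamma> H ip" and g: "g \<in> H" and l: "l \<in> unit_disc"
    and T: "\<And>f. f \<in> H \<Longrightarrow> T f = (\<lambda>z. ip f g * g z)"
  shows "berezin_transform ip (disc_kernel \<gamma>) T l
      = of_real ((norm (g l))\<^sup>2 * (1 - (norm l)\<^sup>2) powr \<gamma>)"
proof -
  interpret disc_rkhs \<gamma> H ip by fact
  have pos: "1 - (norm l)\<^sup>2 > 0"
    using l by (simp add: power_less_one_iff abs_square_less_1)
  have k: "disc_kernel \<gamma> l \<in> H" by (rule kernel_mem[OF l])
  \<comment> \<open>On the diagonal the base is a positive real, so the principal branch agrees with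
    the real power.\<close>
  have "disc_kernel \<gamma> l l = (of_real (1 - (norm l)\<^sup>2)) powr (of_real (- \<gamma>))"
    using l by (simp add: disc_kernel_def on_disc_def mult.commute flip: complex_norm_square)
  also have "\<dots> = of_real ((1 - (norm l)\<^sup>2) powr (- \<gamma>))"
    using pos by (subst powr_of_real) auto
  finally have kl: "ip (disc_kernel \<gamma> l) (disc_kernel \<gamma> l) = of_real ((1 - (norm l)\<^sup>2) powr (- \<gamma>))"
    using reproducing[OF k l] by simp
  define a where "a = ip_norm ip (disc_kernel \<gamma> l)"
  have a2: "a\<^sup>2 = (1 - (norm l)\<^sup>2) powr (- \<gamma>)"
    using ip_norm_power2[OF k] kl by (simp add: a_def)
  define \<kappa> where "\<kappa> = normalized_kernel ip (disc_kernel \<gamma>) l"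
  have \<kappa>_eq: "\<kappa> = (\<lambda>x. of_real (1 / a) * disc_kernel \<gamma> l x)"
    by (simp add: \<kappa>_def normalized_kernel_def a_def fun_eq_iff)
  have \<kappa>: "\<kappa> \<in> H" unfolding \<kappa>_eq by (rule scale_mem[OF k])
  have g\<kappa>: "ip g \<kappa> = of_real (1 / a) * g l"
    unfolding \<kappa>_eq using ip_scale_right[OF k g, of "of_real (1 / a)"] reproducing[OF g l] by simp
  have "berezin_transform ip (disc_kernel \<gamma>) T l = ip \<kappa> g * ip g \<kappa>"
    using T[OF \<kappa>] ip_scale_left[OF g \<kappa>] by (simp add: berezin_transform_def flip: \<kappa>_def)
  also have "\<dots> = of_real ((norm (ip g \<kappa>))\<^sup>2)"
    using ip_commute[OF g \<kappa>] by (simp only: complex_norm_square mult.commute)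
  also have "(norm (ip g \<kappa>))\<^sup>2 = (norm (g l))\<^sup>2 / a\<^sup>2"
    by (simp add: g\<kappa> norm_mult norm_divide power_mult_distrib power_divide)
  also have "\<dots> = (norm (g l))\<^sup>2 * (1 - (norm l)\<^sup>2) powr \<gamma>"
    unfolding a2 by (simp add: powr_minus divide_inverse)
  finally show ?thesis .
qed

section \<open>Maximum and image of the real function t^n (1 - t)^\<gamma>\<close>

text \<open>Weighted AM-GM through logarithms: \<open>ln x \<le> x - 1\<close> is applied at
  \<open>t / p\<close> and \<open>(1 - t) / q\<close>, and since n/p = \<gamma>/q = n + \<gamma> the
  linear bounds sum to 0.\<close>

lemma power_mult_powr_le:
  fixes \<gamma> t :: real
  assumes \<gamma>: "\<gamma> > 0" and n: "n \<ge> 1" and t: "0 \<le> t" "t < 1"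
  shows "t ^ n * (1 - t) powr \<gamma> \<le> (n / (n + \<gamma>)) ^ n * (\<gamma> / (n + \<gamma>)) powr \<gamma>"
proof (cases "t = 0")
  case True
  then show ?thesis using n \<gamma> by (simp add: power_0_left)
next
  case False
  define p q where "p = n / (n + \<gamma>)" and "q = \<gamma> / (n + \<gamma>)"
  have pq: "p > 0" "q > 0" using \<gamma> n by (auto simp: p_def q_def)
  have tp: "t > 0" using t False by simp
  have "n * ln (t / p) + \<gamma> * ln ((1 - t) / q) \<le> n * (t / p - 1) + \<gamma> * ((1 - t) / q - 1)"
    using pq tp t \<gamma> by (intro add_mono mult_left_mono ln_le_minus_one) auto
  also have "\<dots> = 0" using \<gamma> n by (simp add: p_def q_def field_simps)
  finally have "n * ln t + \<gamma> * ln (1 - t) \<le> n * ln p + \<gamma> * ln q"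
    using pq tp t by (simp add: ln_div algebra_simps)
  then have "exp (n * ln t + \<gamma> * ln (1 - t)) \<le> exp (n * ln p + \<gamma> * ln q)" by simp
  then have "t ^ n * (1 - t) powr \<gamma> \<le> p ^ n * q powr \<gamma>"
    using pq tp t by (simp add: exp_add exp_of_nat_mult powr_def)
  then show ?thesis by (simp add: p_def q_def)
qed

lemma image_power_mult_powr:
  fixes \<gamma> :: real
  assumes \<gamma>: "\<gamma> > 0" and n: "n \<ge> 1"
  shows "(\<lambda>t. t ^ n * (1 - t) powr \<gamma>) ` {0..<1}
      = {0 .. \<gamma> powr \<gamma> * real n ^ n / (real n + \<gamma>) powr (real n + \<gamma>)}"
    (is "?\<phi> ` _ = {0..?M}")
proof -
  define p where "p = n / (n + \<gamma>)"
  have p: "0 \<le> p" "p < 1" using \<gamma> n by (auto simp: p_def)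
  have 1: "1 - p = \<gamma> / (n + \<gamma>)" using \<gamma> by (simp add: p_def field_simps)
  have M: "?\<phi> p = ?M"
    unfolding 1 using \<gamma> n by (simp add: p_def powr_add powr_divide power_divide powr_realpow)
  show ?thesis
  proof (intro equalityI subsetI)
    fix y assume "y \<in> ?\<phi> ` {0..<1}"
    then obtain t where "y = ?\<phi> t" "0 \<le> t" "t < 1" by auto
    then show "y \<in> {0..?M}"
      using power_mult_powr_le[OF \<gamma> n, of t] M 1 by (simp add: p_def)
  next
    fix y assume y: "y \<in> {0..?M}"
    \<comment> \<open>Staying in \<open>{0..p}\<close> keeps \<open>1 - t\<close> positive, where
      \<open>powr\<close> is continuous; the value at 0 is 0 because
      \<open>n \<ge> 1\<close>.\<close>
    have "continuous_on {0..p} ?\<phi>"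
      using p by (intro continuous_intros) auto
    then have "\<exists>t\<ge>0. t \<le> p \<and> ?\<phi> t = y"
      using y p M n by (intro IVT') (auto simp: power_0_left)
    then show "y \<in> ?\<phi> ` {0..<1}" using p by auto
  qed
qed

theorem theorem3p2:
  fixes \<gamma> :: real and n :: nat
    and H :: "(complex \<Rightarrow> complex) set"
    and ip :: "(complex \<Rightarrow> complex) \<Rightarrow> (complex \<Rightarrow> complex) \<Rightarrow> complex"
    and T :: "(complex \<Rightarrow> complex) \<Rightarrow> (complex \<Rightarrow> complex)"
  assumes "\<gamma> > 0" and "n \<ge> 1"
    and "disc_rkhs \<gamma> H ip"
    and "\<And>f. f \<in> H \<Longrightarrow> T f = (\<lambda>z. ip f (on_disc (\<lambda>w. w ^ n)) * on_disc (\<lambda>w. w ^ n) z)"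
  shows "berezin_range unit_disc ip (disc_kernel \<gamma>) T
           = complex_of_real ` {0 .. \<gamma> powr \<gamma> * real n ^ n / (real n + \<gamma>) powr (real n + \<gamma>)}
         \<and> convex (berezin_range unit_disc ip (disc_kernel \<gamma>) T)"
proof -
  let ?\<phi> = "\<lambda>t. t ^ n * (1 - t) powr \<gamma>"
  have mem: "on_disc (\<lambda>w. w ^ n) \<in> H"
    by (rule disc_rkhs.monomial_mem[OF assms(3,1)])
  have "berezin_transform ip (disc_kernel \<gamma>) T l = of_real (?\<phi> ((norm l)\<^sup>2))"
    if "l \<in> unit_disc" for l
    by (subst berezin_transform_rank_one[OF assms(3) mem that])
      (use that assms(4) in \<open>simp_all add: on_disc_def norm_power mult.commute flip: power_mult\<close>)
  \<comment> \<open>The transform depends on \<open>l\<close> only through |l|^2, so the range is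
    the image of [0, 1) under a real function.\<close>
  then have "berezin_range unit_disc ip (disc_kernel \<gamma>) T
      = of_real ` ?\<phi> ` (\<lambda>l. (norm l)\<^sup>2) ` unit_disc"
    by (simp add: berezin_range_def image_image)
  also have "(\<lambda>l :: complex. (norm l)\<^sup>2) ` unit_disc = {0..<1}"
  proof (intro equalityI subsetI)
    fix t :: real assume "t \<in> {0..<1}"
    then show "t \<in> (\<lambda>l :: complex. (norm l)\<^sup>2) ` unit_disc"
      by (intro image_eqI[of _ _ "of_real (sqrt t)"]) auto
  qed (auto simp: abs_square_less_1)
  finally have range: "berezin_range unit_disc ip (disc_kernel \<gamma>) T
      = of_real ` {0 .. \<gamma> powr \<gamma> * real n ^ n / (real n + \<gamma>) powr (real n + \<gamma>)}"
    by (simp only: image_power_mult_powr[OF assms(1,2)])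
  moreover have "convex (complex_of_real ` {0..c})" for c
    by (intro convex_linear_image bounded_linear.linear bounded_linear_of_real convex_real_interval)
  ultimately show ?thesis by simp
qed

end
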